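(* For every non-negative integer $m$, \[ \sum_{n=1}^\infty \frac{n}{5^{n+1}}\binom{2n+1}{m}=\frac{(5m+1)F_{m+1}+(5m-3)F_m}{2^{m+4}}, \qquad \sum_{n=1}^\infty \frac{n}{5^{n+1}}\binom{2n}{m}=\frac{(3m+1)F_{m+1}+(m+1)F_m}{2^{m+4}}. \]
   Context: $F_n$ denotes the $n$-th Fibonacci number ($F_0=0$, $F_1=1$, $F_n=F_{n-1}+F_{n-2}$). Binomial coefficients $\binom{N}{m}$ vanish when $m>N$. *)

theory Defs
  imports Complex_Main "HOL-Number_Theory.Fib"
begin

end

theory Submission
  imports Defs
begin

text \<open>
  Write \<open>A\<^sub>m\<close>, \<open>B\<^sub>m\<close> for the sums with \<open>binom (2 n) m\<close> and \<open>binom (2 n + 1) m\<close>, and \<open>a\<^sub>m\<close>, \<open>b\<^sub>m\<close> for their variants without the factor \<open>n\<close>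
  (summed from \<open>n = 0\<close>). Pascal's rule for \<open>binom (2 n + 1) (m + 1)\<close> gives
  \<open>b\<^sub>m\<^sub>+\<^sub>1 = a\<^sub>m + a\<^sub>m\<^sub>+\<^sub>1\<close> and \<open>B\<^sub>m\<^sub>+\<^sub>1 = A\<^sub>m + A\<^sub>m\<^sub>+\<^sub>1\<close>; Pascal's rule for \<open>binom (2 n + 2) (m + 1)\<close>
  together with the index shift \<open>n \<mapsto> n + 1\<close> gives \<open>5 a\<^sub>m\<^sub>+\<^sub>1 = b\<^sub>m + b\<^sub>m\<^sub>+\<^sub>1\<close> and
  \<open>5 (A\<^sub>m\<^sub>+\<^sub>1 - a\<^sub>m\<^sub>+\<^sub>1) = B\<^sub>m + B\<^sub>m\<^sub>+\<^sub>1\<close>. The closed forms satisfy the same recurrences.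
\<close>

text \<open>Since \<open>(2 * n + r) choose m\<close> is at most \<open>2 * 4 ^ n\<close>, a
  multiple of \<open>(n + 1) * (4/5) ^ n\<close> dominates the terms. The bound on \<open>w\<close>
  admits both weights used later, 1 and \<open>n\<close>.\<close>

lemma summable_weighted_binomial:
  fixes w :: "nat \<Rightarrow> real"
  assumes w: "\<And>n. \<bar>w n\<bar> \<le> real (Suc n)" and r: "r \<le> 1"
  shows "summable (\<lambda>n. w n / 5 ^ (n + 1) * real ((2 * n + r) choose m))"
proof (rule summable_comparison_test')
  have "summable (\<lambda>n. real (Suc n) * (4/5) ^ n)"
    using geometric_deriv_sums[of "4/5 :: real"] by (auto simp: sums_iff)
  then show "summable (\<lambda>n. 2/5 * (real (Suc n) * (4/5) ^ n))"
    by (rule summable_mult)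
next
  fix n :: nat
  have "(2 * n + r) choose m \<le> 2 ^ (2 * n + r)"
    by (rule binomial_le_pow2)
  also have "\<dots> \<le> 2 ^ (2 * n + 1)"
    using r by (intro power_increasing) auto
  finally have "real ((2 * n + r) choose m) \<le> real (2 ^ (2 * n + 1))"
    by (rule of_nat_mono)
  also have "real (2 ^ (2 * n + 1)) = 2 * 4 ^ n"
    by (simp add: power_mult)
  finally have c: "real ((2 * n + r) choose m) \<le> 2 * 4 ^ n" .
  have "norm (w n / 5 ^ (n + 1) * real ((2 * n + r) choose m))
      = \<bar>w n\<bar> / 5 ^ (n + 1) * real ((2 * n + r) choose m)"
    by (simp add: abs_mult)
  also have "\<dots> \<le> real (Suc n) / 5 ^ (n + 1) * (2 * 4 ^ n)"
    using w[of n] c by (intro mult_mono divide_right_mono) auto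
  also have "\<dots> = 2/5 * (real (Suc n) * (4/5) ^ n)"
    by (simp add: power_divide)
  finally show "norm (w n / 5 ^ (n + 1) * real ((2 * n + r) choose m))
      \<le> 2/5 * (real (Suc n) * (4/5) ^ n)" .
qed

lemma sums_odd_binomial_step:
  fixes w :: "nat \<Rightarrow> real"
  assumes "(\<lambda>n. w n / 5 ^ (n + 1) * real ((2 * n) choose m)) sums a"
    and "(\<lambda>n. w n / 5 ^ (n + 1) * real ((2 * n) choose Suc m)) sums a'"
  shows "(\<lambda>n. w n / 5 ^ (n + 1) * real ((2 * n + 1) choose Suc m)) sums (a + a')"
  using sums_add[OF assms] by (simp add: algebra_simps add_divide_distrib)

text \<open>The index shift turns \<open>w n\<close> into \<open>w (n - 1)\<close>. No boundary term
  appears, since \<open>0 choose Suc m\<close> is 0.\<close>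

lemma sums_even_binomial_step:
  fixes w :: "nat \<Rightarrow> real"
  assumes "(\<lambda>n. w n / 5 ^ (n + 1) * real ((2 * n + 1) choose m)) sums b"
    and "(\<lambda>n. w n / 5 ^ (n + 1) * real ((2 * n + 1) choose Suc m)) sums b'"
  shows "(\<lambda>n. w (n - 1) / 5 ^ (n + 1) * real ((2 * n) choose Suc m)) sums ((b + b') / 5)"
proof -
  have "(\<lambda>n. (w n / 5 ^ (n + 1) * real ((2 * n + 1) choose m)
      + w n / 5 ^ (n + 1) * real ((2 * n + 1) choose Suc m)) / 5) sums ((b + b') / 5)"
    by (intro sums_divide sums_add assms)
  also have "(\<lambda>n. (w n / 5 ^ (n + 1) * real ((2 * n + 1) choose m)
      + w n / 5 ^ (n + 1) * real ((2 * n + 1) choose Suc m)) / 5)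
    = (\<lambda>n. w (Suc n - 1) / 5 ^ (Suc n + 1) * real ((2 * Suc n) choose Suc m))"
    by (simp add: fun_eq_iff field_simps)
  finally show ?thesis
    by (subst (asm) sums_Suc_iff) simp
qed

text \<open>The unknown \<open>x\<close> is on both sides because the odd sum at
  \<open>Suc m\<close> contains the even sum at \<open>Suc m\<close>. The correction
  \<open>t\<close> is 0 for weight 1 and the unweighted even sum for weight
  \<open>n\<close>.\<close>

lemma solve_recurrence:
  fixes x :: real
  assumes "x - t = (u + (v + x)) / 5"
  shows "x = (5 * t + u + v) / 4"
  using assms by (simp add: field_simps)

lemma sums_binomial_fib:
  "(\<lambda>n. 1 / 5 ^ (n + 1) * real ((2 * n) choose m)) sums (real (fib (m + 1)) / 2 ^ (m + 2)) \<and>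
   (\<lambda>n. 1 / 5 ^ (n + 1) * real ((2 * n + 1) choose m))
     sums ((2 * real (fib m) + real (fib (m + 1))) / 2 ^ (m + 2))"
proof (induction m)
  case 0
  have "(\<lambda>n. 1 / 5 * (1 / 5) ^ n :: real) sums (1 / 5 * (1 / (1 - 1 / 5)))"
    by (intro sums_mult geometric_sums) simp
  then show ?case by (simp add: power_divide)
next
  case (Suc m)
  define a where "a = (\<Sum>n. 1 / 5 ^ (n + 1) * real ((2 * n) choose Suc m))"
  have a: "(\<lambda>n. 1 / 5 ^ (n + 1) * real ((2 * n) choose Suc m)) sums a"
    unfolding a_def
    using summable_weighted_binomial[of "\<lambda>_. 1" 0 "Suc m"] by (intro summable_sums) simp
  note b = sums_odd_binomial_step[OF conjunct1[OF Suc.IH] a]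
  have "a = ((2 * real (fib m) + real (fib (m + 1))) / 2 ^ (m + 2)
      + (real (fib (m + 1)) / 2 ^ (m + 2) + a)) / 5"
    \<comment> \<open>For constant weight, \<open>w (n - 1)\<close> and \<open>w n\<close> agree, so
      both facts evaluate the same series.\<close>
    using sums_unique2[OF a sums_even_binomial_step[OF conjunct2[OF Suc.IH] b]] .
  then have "a = ((2 * real (fib m) + real (fib (m + 1))) / 2 ^ (m + 2)
      + real (fib (m + 1)) / 2 ^ (m + 2)) / 4"
    using solve_recurrence[of a 0] by simp
  also have "\<dots> = real (fib (Suc m + 1)) / 2 ^ (Suc m + 2)"
    by (simp add: field_simps)
  finally have "a = real (fib (Suc m + 1)) / 2 ^ (Suc m + 2)" .
  with a b show ?case
    by (simp add: field_simps)
qed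

lemma sums_index_binomial_fib:
  "(\<lambda>n. real n / 5 ^ (n + 1) * real ((2 * n) choose m))
     sums (((3 * real m + 1) * real (fib (m + 1)) + (real m + 1) * real (fib m)) / 2 ^ (m + 4)) \<and>
   (\<lambda>n. real n / 5 ^ (n + 1) * real ((2 * n + 1) choose m))
     sums (((5 * real m + 1) * real (fib (m + 1)) + (5 * real m - 3) * real (fib m)) / 2 ^ (m + 4))"
proof (induction m)
  case 0
  \<comment> \<open>Differentiated geometric series at 1/5; the factor 1/25 comes from the exponent
    \<open>Suc n + 1\<close> after shifting past the zero term.\<close>
  have "(\<lambda>n. 1 / 25 * (real (Suc n) * (1 / 5) ^ n)) sums (1 / 25 * (1 / (1 - 1 / 5)\<^sup>2))"
    by (intro sums_mult geometric_deriv_sums) simp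
  also have "(\<lambda>n. 1 / 25 * (real (Suc n) * (1 / 5) ^ n)) = (\<lambda>n. real (Suc n) / 5 ^ (Suc n + 1))"
    by (simp add: power_divide)
  finally have "(\<lambda>n. real n / 5 ^ (n + 1)) sums (1 / 16)"
    by (subst (asm) sums_Suc_iff) (simp add: power2_eq_square)
  then show ?case by simp
next
  case (Suc m)
  define a where "a = (\<Sum>n. real n / 5 ^ (n + 1) * real ((2 * n) choose Suc m))"
  have a: "(\<lambda>n. real n / 5 ^ (n + 1) * real ((2 * n) choose Suc m)) sums a"
    unfolding a_def
    using summable_weighted_binomial[of real 0 "Suc m"] by (intro summable_sums) simp
  note b = sums_odd_binomial_step[OF conjunct1[OF Suc.IH] a]
  \<comment> \<open>At \<open>n = 0\<close> truncation makes \<open>n - 1\<close> equal to 0 rather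
    than -1, but the binomial coefficient vanishes there.\<close>
  have "real n / 5 ^ (n + 1) * real ((2 * n) choose Suc m)
      - 1 / 5 ^ (n + 1) * real ((2 * n) choose Suc m)
    = real (n - 1) / 5 ^ (n + 1) * real ((2 * n) choose Suc m)" for n
    by (cases n) (simp_all add: field_simps)
  then have "(\<lambda>n. real (n - 1) / 5 ^ (n + 1) * real ((2 * n) choose Suc m))
      sums (a - real (fib (Suc m + 1)) / 2 ^ (Suc m + 2))"
    using sums_diff[OF a conjunct1[OF sums_binomial_fib[of "Suc m"]]] by simp
  from sums_unique2[OF this sums_even_binomial_step[OF conjunct2[OF Suc.IH] b]]
  have "a = (5 * (real (fib (Suc m + 1)) / 2 ^ (Suc m + 2))
      + ((5 * real m + 1) * real (fib (m + 1)) + (5 * real m - 3) * real (fib m)) / 2 ^ (m + 4)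
      + ((3 * real m + 1) * real (fib (m + 1)) + (real m + 1) * real (fib m)) / 2 ^ (m + 4)) / 4"
    by (rule solve_recurrence)
  also have "\<dots> = ((3 * real (Suc m) + 1) * real (fib (Suc m + 1))
      + (real (Suc m) + 1) * real (fib (Suc m))) / 2 ^ (Suc m + 4)"
    by (simp add: power_add field_simps)
  finally have a_eq: "a = ((3 * real (Suc m) + 1) * real (fib (Suc m + 1))
      + (real (Suc m) + 1) * real (fib (Suc m))) / 2 ^ (Suc m + 4)" .
  have "((3 * real m + 1) * real (fib (m + 1)) + (real m + 1) * real (fib m)) / 2 ^ (m + 4) + a
    = ((5 * real (Suc m) + 1) * real (fib (Suc m + 1))
      + (5 * real (Suc m) - 3) * real (fib (Suc m))) / 2 ^ (Suc m + 4)"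
    unfolding a_eq by (simp add: power_add field_simps)
  with a b show ?case
    unfolding a_eq by simp
qed

theorem theorem5:
  fixes m :: nat
  shows "(\<lambda>k. let n = k + 1 in real n / 5 ^ (n + 1) * real ((2 * n + 1) choose m))
           sums (((5 * real m + 1) * real (fib (m + 1)) + (5 * real m - 3) * real (fib m)) / 2 ^ (m + 4))
         \<and> (\<lambda>k. let n = k + 1 in real n / 5 ^ (n + 1) * real ((2 * n) choose m))
           sums (((3 * real m + 1) * real (fib (m + 1)) + (real m + 1) * real (fib m)) / 2 ^ (m + 4))"
proof -
  have shift: "(\<lambda>k. let n = k + 1 in f n) sums s" if "f sums s" "f 0 = 0"
    for f :: "nat \<Rightarrow> real" and s
    using that by (simp add: Let_def sums_Suc_iff)
  show ?thesis
    by (intro conjI shift conjunct1[OF sums_index_binomial_fib] conjunct2[OF sums_index_binomial_fib])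
      simp_all
qed

end
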